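(* Let $\omega>0$ and $q>p>1$ be real numbers, and for $u>0$ put $f(u)=-\omega u+u^p-u^q$ and $F(u)=\int_0^u f(s)\,ds$. If $F(u)>0$ for some $u>0$, then $$\tilde f(u):=(uf'(u))'f(u)-u f'(u)^2<0 \quad\text{for every } u>0.$$
   Context: Primes denote differentiation with respect to $u$; thus $(uf'(u))'=\frac{d}{du}\bigl(u f'(u)\bigr)$. The exponents $p,q$ are real. *)

theory Defs
  imports "HOL-Analysis.Analysis"
begin

text \<open>Real exponents are rendered by \<open>powr\<close>; since \<open>0 powr a = 0\<close>, the function \<open>nlf\<close>
  takes the expected value 0 at 0, so it is continuous on \<open>{0..}\<close> for \<open>p, q > 1\<close>.\<close>

definition nlf :: "real \<Rightarrow> real \<Rightarrow> real \<Rightarrow> real \<Rightarrow> real" where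
  "nlf \<omega> p q u = - \<omega> * u + u powr p - u powr q"

definition nlF :: "real \<Rightarrow> real \<Rightarrow> real \<Rightarrow> real \<Rightarrow> real" where
  "nlF \<omega> p q u = integral {0..u} (nlf \<omega> p q)"

definition tilde :: "(real \<Rightarrow> real) \<Rightarrow> real \<Rightarrow> real" where
  "tilde f u = deriv (\<lambda>v. v * deriv f v) u * f u - u * (deriv f u)\<^sup>2"

end

theory Submission
  imports Defs
begin

text \<open>Positivity of \<open>F\<close> somewhere forces \<open>f s > 0\<close> for some \<open>s > 0\<close>, and nothing more is needed.
  Put \<open>\<theta> = (p - 1) / (q - 1)\<close>. With \<open>P = u powr (p - 1)\<close> and \<open>Q = u powr (q - 1)\<close>, so that
  \<open>P = Q powr \<theta>\<close>, the quantity \<open>tilde f u\<close> equals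
  \<open>u * (q - 1)\<^sup>2 * (\<omega> * Q - \<omega> * \<theta>\<^sup>2 * P - (1 - \<theta>)\<^sup>2 * P * Q)\<close>.
  By weighted AM-GM, positivity of \<open>f\<close> at \<open>s\<close> gives
  \<open>\<omega> powr (1 - \<theta>) < \<theta> powr \<theta> * (1 - \<theta>) powr (1 - \<theta>)\<close>, and by weighted AM-GM again
  this bound makes the bracket negative.\<close>

lemma exists_pos_of_integral_pos:
  fixes f :: "real \<Rightarrow> real"
  assumes "integral S f > 0"
  shows "\<exists>s\<in>S. f s > 0"
proof (rule ccontr)
  assume "\<not> ?thesis"
  then have np: "\<And>s. s \<in> S \<Longrightarrow> f s \<le> 0"
    by (simp add: not_less)
  show False
  proof (cases "f integrable_on S")
    case True
    with np have "integral S f \<le> integral S (\<lambda>_. 0)"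
      by (intro integral_le integrable_0) auto
    with assms show False by simp
  next
    \<comment> \<open>Here \<open>integral\<close> takes its default value 0, contradicting
      positivity.\<close>
    case False
    with assms show False by (simp add: not_integrable_integral)
  qed
qed

lemma powr_bound_of_less_powr:
  fixes \<omega> w \<theta> :: real
  assumes \<theta>: "0 < \<theta>" "\<theta> < 1" and "\<omega> > 0" "w > 0" and less: "\<omega> + w < w powr \<theta>"
  shows "\<omega> powr (1 - \<theta>) < \<theta> powr \<theta> * (1 - \<theta>) powr (1 - \<theta>)"
proof -
  \<comment> \<open>Dividing by the weights makes the weighted mean exactly
    \<open>\<omega> + w\<close>; the factor \<open>w powr \<theta>\<close> then cancels against the
    assumption.\<close>
  have "(w / \<theta>) powr \<theta> * (\<omega> / (1 - \<theta>)) powr (1 - \<theta>) \<le> \<theta> * (w / \<theta>) + (1 - \<theta>) * (\<omega> / (1 - \<theta>))"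
    using assms by (intro Youngs_inequality_0) auto
  also have "\<dots> = \<omega> + w"
    using \<theta> by simp
  finally have "w powr \<theta> * (\<omega> powr (1 - \<theta>) / (\<theta> powr \<theta> * (1 - \<theta>) powr (1 - \<theta>))) < w powr \<theta> * 1"
    using assms by (simp add: powr_divide)
  then have "\<omega> powr (1 - \<theta>) / (\<theta> powr \<theta> * (1 - \<theta>) powr (1 - \<theta>)) < 1"
    using \<open>w > 0\<close> by (subst (asm) mult_less_cancel_left_pos) auto
  then show ?thesis
    using \<theta> by (simp add: divide_less_eq)
qed

text \<open>After division by \<open>v\<close> the right side is
  \<open>\<theta> * x + (1 - \<theta>) * y\<close> for the \<open>x\<close>, \<open>y\<close> below.
  In its AM-GM lower bound \<open>x powr \<theta> * y powr (1 - \<theta>)\<close> the powers of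
  \<open>v\<close> cancel, so the bound on \<open>\<omega>\<close> serves every
  \<open>v\<close>.\<close>

lemma bracket_neg:
  fixes \<omega> v \<theta> :: real
  assumes \<theta>: "0 < \<theta>" "\<theta> < 1" and "\<omega> > 0" "v > 0"
    and bound: "\<omega> powr (1 - \<theta>) < \<theta> powr \<theta> * (1 - \<theta>) powr (1 - \<theta>)"
  shows "\<omega> * v < \<omega> * \<theta>\<^sup>2 * v powr \<theta> + (1 - \<theta>)\<^sup>2 * v powr \<theta> * v"
proof -
  define x where "x = \<omega> * \<theta> * v powr (\<theta> - 1)"
  define y where "y = (1 - \<theta>) * v powr \<theta>"
  have "\<omega> = \<omega> powr \<theta> * \<omega> powr (1 - \<theta>)"
    using \<open>\<omega> > 0\<close> by (simp flip: powr_add)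
  also have "\<dots> < \<omega> powr \<theta> * (\<theta> powr \<theta> * (1 - \<theta>) powr (1 - \<theta>))"
    using bound \<open>\<omega> > 0\<close> by simp
  \<comment> \<open>The exponent of \<open>v\<close> is 0; its two summands are the contributions of
    \<open>x\<close> and \<open>y\<close>.\<close>
  also have "\<dots> = \<omega> powr \<theta> * (\<theta> powr \<theta> * (1 - \<theta>) powr (1 - \<theta>))
      * v powr ((\<theta> - 1) * \<theta> + \<theta> * (1 - \<theta>))"
    using \<open>v > 0\<close> by (simp add: algebra_simps)
  also have "\<dots> = x powr \<theta> * y powr (1 - \<theta>)"
    unfolding x_def y_def powr_add using assms
    by (simp add: powr_mult powr_powr mult_ac)
  also have "\<dots> \<le> \<theta> * x + (1 - \<theta>) * y"
    using assms by (intro Youngs_inequality_0) (auto simp: x_def y_def)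
  finally have "\<omega> * v < (\<theta> * x + (1 - \<theta>) * y) * v"
    using \<open>v > 0\<close> by simp
  also have "v powr (\<theta> - 1) * v = v powr \<theta>"
    using \<open>v > 0\<close> by (simp add: powr_diff)
  then have "(\<theta> * x + (1 - \<theta>) * y) * v = \<omega> * \<theta>\<^sup>2 * v powr \<theta> + (1 - \<theta>)\<^sup>2 * v powr \<theta> * v"
    unfolding x_def y_def by (simp add: algebra_simps power2_eq_square)
  finally show ?thesis .
qed

lemma deriv_nlf:
  assumes "u > 0"
  shows "deriv (nlf \<omega> p q) u = - \<omega> + p * u powr (p - 1) - q * u powr (q - 1)"
  unfolding nlf_def [abs_def] using assms
  by (intro DERIV_imp_deriv) (auto intro!: derivative_eq_intros)

lemma deriv_times_deriv_nlf:
  assumes "u > 0"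
  shows "deriv (\<lambda>v. v * deriv (nlf \<omega> p q) v) u
    = - \<omega> + p\<^sup>2 * u powr (p - 1) - q\<^sup>2 * u powr (q - 1)"
proof -
  let ?g = "\<lambda>v. - \<omega> * v + p * v powr p - q * v powr q"
  \<comment> \<open>The formula for the inner derivative is available for positive arguments, so it
    is substituted on a neighbourhood of \<open>u\<close>.\<close>
  have "\<forall>\<^sub>F v in nhds u. v > 0"
    using assms eventually_nhds_in_open [of "{0<..}" u] by simp
  then have "\<forall>\<^sub>F v in nhds u. v * deriv (nlf \<omega> p q) v = ?g v"
    by eventually_elim (simp add: deriv_nlf powr_diff field_simps)
  then have "deriv (\<lambda>v. v * deriv (nlf \<omega> p q) v) u = deriv ?g u"
    by (intro deriv_cong_ev refl)
  also have "\<dots> = - \<omega> + p\<^sup>2 * u powr (p - 1) - q\<^sup>2 * u powr (q - 1)"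
    using assms
    by (intro DERIV_imp_deriv) (auto intro!: derivative_eq_intros simp: power2_eq_square)
  finally show ?thesis .
qed

text \<open>On expansion the square terms in \<open>\<omega>\<close>, \<open>P\<close> and
  \<open>Q\<close> cancel; each mixed term carries the squared difference of two of the exponents 1,
  \<open>p\<close>, \<open>q\<close>.\<close>

lemma tilde_nlf:
  fixes p q u :: real
  assumes "u > 0"
  defines "P \<equiv> u powr (p - 1)" and "Q \<equiv> u powr (q - 1)"
  shows "tilde (nlf \<omega> p q) u
    = u * (\<omega> * (q - 1)\<^sup>2 * Q - \<omega> * (p - 1)\<^sup>2 * P - (q - p)\<^sup>2 * P * Q)"
proof -
  have "nlf \<omega> p q u = u * (- \<omega> + P - Q)"
    using assms by (simp add: nlf_def P_def Q_def algebra_simps powr_mult_base)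
  then show ?thesis
    unfolding tilde_def deriv_times_deriv_nlf [OF assms(1)] deriv_nlf [OF assms(1)]
    by (simp only:) (simp add: P_def [symmetric] Q_def [symmetric] algebra_simps power2_eq_square)
qed

theorem corollary1:
  fixes \<omega> p q :: real
  assumes "\<omega> > 0" and "p > 1" and "q > p"
    and "\<exists>u>0. nlF \<omega> p q u > 0"
  shows "\<forall>u>0. tilde (nlf \<omega> p q) u < 0"
proof (intro allI impI)
  fix u :: real
  assume "u > 0"
  define \<theta> where "\<theta> = (p - 1) / (q - 1)"
  have \<theta>: "0 < \<theta>" "\<theta> < 1" and p1: "p - 1 = (q - 1) * \<theta>"
    using assms(2,3) by (auto simp: \<theta>_def)
  have qp: "q - p = (q - 1) * (1 - \<theta>)"
    using p1 by (simp add: algebra_simps)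
  from assms(4) obtain s where "s \<ge> 0" and fs: "nlf \<omega> p q s > 0"
    unfolding nlF_def by (metis exists_pos_of_integral_pos atLeastAtMost_iff)
  \<comment> \<open>The integration interval contains 0, but \<open>nlf\<close> vanishes there
    because \<open>0 powr a = 0\<close>.\<close>
  from fs have "s \<noteq> 0"
    by (auto simp: nlf_def)
  with \<open>s \<ge> 0\<close> have "s > 0" by simp
  have "nlf \<omega> p q s = s * (s powr (p - 1) - (\<omega> + s powr (q - 1)))"
    using \<open>s > 0\<close> by (simp add: nlf_def algebra_simps powr_mult_base)
  \<comment> \<open>Dividing by \<open>s\<close> turns positivity at \<open>s\<close> into the AM-GM
    hypothesis with \<open>w = s powr (q - 1)\<close>.\<close>
  with fs \<open>s > 0\<close> have "\<omega> + s powr (q - 1) < (s powr (q - 1)) powr \<theta>"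
    by (simp add: zero_less_mult_iff powr_powr p1)
  with \<theta> assms(1) \<open>s > 0\<close> have bound: "\<omega> powr (1 - \<theta>) < \<theta> powr \<theta> * (1 - \<theta>) powr (1 - \<theta>)"
    by (intro powr_bound_of_less_powr [of _ _ "s powr (q - 1)"]) auto
  define Q where "Q = u powr (q - 1)"
  have "Q > 0" and P: "u powr (p - 1) = Q powr \<theta>"
    using \<open>u > 0\<close> by (simp_all add: Q_def powr_powr p1)
  have "tilde (nlf \<omega> p q) u = u * (q - 1)\<^sup>2
      * (\<omega> * Q - (\<omega> * \<theta>\<^sup>2 * Q powr \<theta> + (1 - \<theta>)\<^sup>2 * Q powr \<theta> * Q))"
    unfolding tilde_nlf [OF \<open>u > 0\<close>] P Q_def [symmetric] unfolding p1 qp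
    unfolding power_mult_distrib by (simp add: algebra_simps)
  moreover have "\<omega> * Q < \<omega> * \<theta>\<^sup>2 * Q powr \<theta> + (1 - \<theta>)\<^sup>2 * Q powr \<theta> * Q"
    by (rule bracket_neg [OF \<theta> assms(1) \<open>Q > 0\<close> bound])
  ultimately show "tilde (nlf \<omega> p q) u < 0"
    using \<open>u > 0\<close> assms(2,3) by (simp add: mult_pos_neg)
qed

end
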